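(* Let $q$ be a prime power, let $C\subseteq\mathbb{F}_q^n$ be an $[n,k]$ code over $\mathbb{F}_q$, let $1\le d\le n$, let $f\in\mathrm{Harm}_d(n)$, and let $m$ be a positive integer. Then, as rational functions in $x,y$, $$Z_{C,f}(x,y;q^m)=(-1)^{d}(x-y)^{k-d}\,y^{n-k-d}\;T\left(M_{C},f;\;\frac{x+(q^{m}-1)y}{x-y},\;\frac{x}{y}\right).$$
   Context: Let $E=\{1,\dots,n\}$ and let $E_d$ be the set of $d$-element subsets of $E$. $\mathrm{Harm}_d(n)$ is the space of functions $f:E_d\to\mathbb{R}$ such that $\sum_{Z\in E_d,\,Y\subseteq Z}f(Z)=0$ for every $Y\in E_{d-1}$. For $X\subseteq E$ put $\widetilde f(X)=\sum_{Z\in E_d,\,Z\subseteq X}f(Z)$. An $[n,k]$ code over $\mathbb{F}_q$ is a $k$-dimensional linear subspace of $\mathbb{F}_q^n$. For a vector $\mathbf u$, $\mathrm{supp}(\mathbf u)=\{i\in E: u_i\ne 0\}$ and $\mathrm{wt}(\mathbf u)=|\mathrm{supp}(\mathbf u)|$. For a positive integer $m$, $C[q^m]=C\otimes\mathbb{F}_{q^m}\subseteq\mathbb{F}_{q^m}^n$ is the $\mathbb{F}_{q^m}$-linear span of $C$, and $A_{i,f}^{q^m}(C)=\sum_{\mathbf u\in C[q^m],\,\mathrm{wt}(\mathbf u)=i}\widetilde f(\mathrm{supp}(\mathbf u))$. The harmonic $q^m$-extended weight enumerator $W_{C,f}(x,y;q^m)=\sum_{i=0}^nA_{i,f}^{q^m}(C)x^{n-i}y^i$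 equals $(xy)^dZ_{C,f}(x,y;q^m)$, where $Z_{C,f}(x,y;q^m)=\sum_{i=d}^{n-d}A_{i,f}^{q^m}(C)x^{n-i-d}y^{i-d}$ (an empty sum is $0$). $M_C$ is the vector matroid on $E$ of a generator matrix $G$ of $C$ (a $k\times n$ matrix whose rows form a basis of $C$): a set $I\subseteq E$ is independent iff the columns of $G$ indexed by $I$ are linearly independent; it does not depend on the choice of $G$. For a matroid $M$ on $E$ with rank function $\rho$, the harmonic Tutte polynomial of $M$ associated to $f$ is $$T(M,f;x,y)=\sum_{X\subseteq E}\widetilde f(X)\,(x-1)^{\rho(E)-\rho(X)}(y-1)^{|X|-\rho(X)}.$$ *)

theory Defs
  imports
    "HOL-Analysis.Cartesian_Space"
    "HOL-Computational_Algebra.Polynomial"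
    "HOL-Computational_Algebra.Polynomial_Factorial"
    "HOL-Number_Theory.Prime_Powers"
begin

text \<open>
  The ground set \<open>E = {1,...,n}\<close> is a finite index type \<open>'n\<close> with \<open>CARD('n) = n\<close>;
  vectors of length \<open>n\<close> over a finite field \<open>'a\<close> are elements of \<open>'a^'n\<close>.
\<close>

subsection \<open>Discrete harmonic functions\<close>

text \<open>
  A function on the \<open>d\<close>-element subsets of \<open>E\<close> is represented by a total function on sets.
  Both definitions below only look at its values on sets of cardinality \<open>d\<close>.
  The expression \<open>d - 1\<close> is truncated, so \<open>Harm d\<close> is meant for \<open>d \<ge> 1\<close>.
\<close>

definition Harm :: "nat \<Rightarrow> ('n::finite set \<Rightarrow> real) set" where
  "Harm d = {f. \<forall>Y. card Y = d - 1 \<longrightarrow> (\<Sum>Z | card Z = d \<and> Y \<subseteq> Z. f Z) = 0}"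

definition harm_tilde :: "nat \<Rightarrow> ('n::finite set \<Rightarrow> real) \<Rightarrow> 'n set \<Rightarrow> real" where
  "harm_tilde d f X = (\<Sum>Z | card Z = d \<and> Z \<subseteq> X. f Z)"

subsection \<open>Codes and their extensions\<close>

definition linear_code :: "nat \<Rightarrow> ('a::{field,finite} ^ 'n) set \<Rightarrow> bool" where
  "linear_code k C \<longleftrightarrow> vec.subspace C \<and> vec.dim C = k"

definition supp :: "'a::zero ^ 'n \<Rightarrow> 'n set" where
  "supp u = {i. u $ i \<noteq> 0}"

definition wt :: "'a::zero ^ 'n \<Rightarrow> nat" where
  "wt u = card (supp u)"

definition field_embedding :: "('a::field \<Rightarrow> 'b::field) \<Rightarrow> bool" where
  "field_embedding h \<longleftrightarrow>
     h 1 = 1 \<and> (\<forall>a b. h (a + b) = h a + h b) \<and> (\<forall>a b. h (a * b) = h a * h b)"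

text \<open>
  For an embedding \<open>h\<close> of \<open>GF(q)\<close> into \<open>GF(q^m)\<close>, this is \<open>C[q^m]\<close>: the span of \<open>C\<close>
  with scalars from the larger field.
\<close>

definition ext_code :: "('a::field \<Rightarrow> 'b::field) \<Rightarrow> ('a ^ 'n) set \<Rightarrow> ('b ^ 'n) set" where
  "ext_code h C = vec.span ((\<lambda>u. \<chi> i. h (u $ i)) ` C)"

definition harm_weight_coeff ::
  "nat \<Rightarrow> ('n::finite set \<Rightarrow> real) \<Rightarrow> ('b::{field,finite} ^ 'n) set \<Rightarrow> nat \<Rightarrow> real" where
  "harm_weight_coeff d f D i = (\<Sum>u | u \<in> D \<and> wt u = i. harm_tilde d f (supp u))"

subsection \<open>Bivariate polynomials and rational functions\<close>

text \<open>
  \<open>\<real>[x,y]\<close> is \<open>real poly poly\<close>, with \<open>x\<close> the variable of the inner and \<open>y\<close> the variable of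
  the outer polynomial ring; \<open>\<real>(x,y)\<close> is its fraction field.
\<close>

type_synonym ratfun2 = "real poly poly fract"

definition varX :: "real poly poly" where
  "varX = [:[:0, 1:]:]"

definition varY :: "real poly poly" where
  "varY = [:0, 1:]"

definition const2 :: "real \<Rightarrow> real poly poly" where
  "const2 r = [:[:r:]:]"

text \<open>\<open>subst2 p a b\<close> is \<open>p\<close> with \<open>a\<close> substituted for \<open>x\<close> and \<open>b\<close> substituted for \<open>y\<close>.\<close>

definition subst2 :: "real poly poly \<Rightarrow> ratfun2 \<Rightarrow> ratfun2 \<Rightarrow> ratfun2" where
  "subst2 p a b =
     poly (map_poly (\<lambda>c. poly (map_poly (\<lambda>r. to_fract (const2 r)) c) a) p) b"

text \<open>
  \<open>Z_{C,f}(x,y;q^m)\<close>, as a function of the extended code \<open>D = C[q^m]\<close>. For \<open>d \<le> n\<close> no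
  subtraction is truncated, and the sum is empty if \<open>n - d < d\<close>.
\<close>

definition harm_Z ::
  "nat \<Rightarrow> ('n::finite set \<Rightarrow> real) \<Rightarrow> ('b::{field,finite} ^ 'n) set \<Rightarrow> real poly poly" where
  "harm_Z d f D =
     (\<Sum>i = d..CARD('n) - d.
        const2 (harm_weight_coeff d f D i) * varX ^ (CARD('n) - i - d) * varY ^ (i - d))"

subsection \<open>Matroids and the harmonic Tutte polynomial\<close>

text \<open>
  A matroid on \<open>E\<close> is given by its family of independent sets. The truncated subtractions in
  \<open>harm_tutte\<close> are exact for a matroid, because its rank function is monotone and bounded by
  the cardinality.
\<close>

type_synonym 'n matroid = "'n set set"

definition matroid_rank :: "'n::finite matroid \<Rightarrow> 'n set \<Rightarrow> nat" where
  "matroid_rank M X = Max (card ` {I \<in> M. I \<subseteq> X})"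

definition harm_tutte ::
  "'n::finite matroid \<Rightarrow> nat \<Rightarrow> ('n set \<Rightarrow> real) \<Rightarrow> real poly poly" where
  "harm_tutte M d f =
     (\<Sum>X\<in>UNIV. const2 (harm_tilde d f X)
        * (varX - 1) ^ (matroid_rank M UNIV - matroid_rank M X)
        * (varY - 1) ^ (card X - matroid_rank M X))"

text \<open>
  A \<open>k \<times> n\<close> matrix is given by its rows \<open>G 0, ..., G (k - 1)\<close>. Indexing the rows by \<open>nat\<close>
  rather than by a finite type admits \<open>k = 0\<close>.
\<close>

definition generator_matrix ::
  "nat \<Rightarrow> (nat \<Rightarrow> 'a::{field,finite} ^ 'n) \<Rightarrow> ('a ^ 'n) set \<Rightarrow> bool" where
  "generator_matrix k G C \<longleftrightarrow>
     inj_on G {..<k} \<and> vec.independent (G ` {..<k}) \<and> vec.span (G ` {..<k}) = C"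

text \<open>
  Linear independence of columns is that of the indexed family: two equal columns are
  dependent, which independence of the set of columns would not express.
\<close>

definition columns_independent :: "nat \<Rightarrow> (nat \<Rightarrow> 'a::field ^ 'n::finite) \<Rightarrow> 'n set \<Rightarrow> bool" where
  "columns_independent k G I \<longleftrightarrow>
     (\<forall>c. (\<forall>r<k. (\<Sum>i\<in>I. c i * G r $ i) = 0) \<longrightarrow> (\<forall>i\<in>I. c i = 0))"

definition vector_matroid :: "nat \<Rightarrow> (nat \<Rightarrow> 'a::field ^ 'n::finite) \<Rightarrow> 'n matroid" where
  "vector_matroid k G = {I. columns_independent k G I}"

lemma generator_matrix_exists:
  assumes "linear_code k C"
  shows "\<exists>G. generator_matrix k G C"
proof -
  from assms have C: "vec.subspace C" "vec.dim C = k"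
    by (auto simp: linear_code_def)
  obtain B where B: "B \<subseteq> C" "vec.independent B" "C \<subseteq> vec.span B" "card B = vec.dim C"
    using vec.basis_exists[of C] by blast
  have "finite B" by simp
  then obtain G where "bij_betw G {0..<card B} B"
    using ex_bij_betw_nat_finite by blast
  then have G: "inj_on G {..<k}" "G ` {..<k} = B"
    using B(4) C(2) by (auto simp: bij_betw_def lessThan_atLeast0)
  have "vec.span B = C"
    using B(1,3) C(1) vec.span_minimal by blast
  then show ?thesis
    using B(2) G unfolding generator_matrix_def by blast
qed

end

theory Submission
  imports Defs
begin

text \<open>Write \<open>Q = q^m\<close>, \<open>D\<close> for the extended code, \<open>\<rho>\<close> for the rank function
  of the matroid, and \<open>F X\<close> for the sum of \<open>f\<close> over the \<open>d\<close>-subsets of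
  \<open>X\<close>. In the right-hand side the powers of \<open>y\<close> and \<open>x - y\<close> combine,
  and what remains is
  \<open>(-1)^d\<close> times the sum over \<open>X\<close> of
  \<open>F X * Q^(k - \<rho> X) * y^(n - |X| - d) * (x - y)^(|X| - d)\<close>.

  Three facts evaluate this sum. First, \<open>F (-X) = (-1)^d * F X\<close> for harmonic \<open>f\<close>
  (\<open>subset_sum_Compl\<close>); replacing \<open>X\<close> by its complement therefore removes the sign
  and changes \<open>\<rho> X\<close> into \<open>\<rho> (-X)\<close>. Second, \<open>Q^(k - \<rho> (-X))\<close> is
  the number of words of \<open>D\<close> supported in \<open>X\<close>
  (\<open>card_ext_code_vanishing\<close>), so the sum becomes one over pairs of a codeword
  \<open>u\<close> and a set \<open>X \<supseteq> supp u\<close>. Third, for fixed \<open>S = supp u\<close> the sum over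
  \<open>X \<supseteq> S\<close> of \<open>F X * y^(|X| - d) * (x - y)^(n - |X| - d)\<close> collapses to
  \<open>F S * y^(|S| - d) * x^(n - |S| - d)\<close> (\<open>harmonic_sum_supersets\<close>), and the sum of
  these terms over \<open>D\<close> is the weight enumerator: words of weight below \<open>d\<close> or
  above \<open>n - d\<close> drop out, since \<open>F S\<close> is an empty sum in the first case and
  \<open>F (-S)\<close> in the second.

  Both facts on harmonic functions follow from one identity,
  \<open>harmonic_sum_by_intersection\<close>: weighting each \<open>d\<close>-set \<open>Z\<close> by
  \<open>x\<close> per point inside \<open>S\<close> and \<open>y\<close> per point outside \<open>S\<close> gives
  \<open>(x - y)^d * F S\<close>, because inclusion-exclusion leaves only the top-degree terms. The count
  of codewords rests on dual families: \<open>I\<close> is an independent set of columns of the generator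
  matrix precisely when the code restricts onto all vectors indexed by \<open>I\<close>, and this
  surjectivity passes to the extended code by applying the embedding to the words that witness it.

  The exponents \<open>n - |X| - d\<close> and \<open>|X| - d\<close> may be negative, so the computation takes
  place in the field of rational functions with integer powers.\<close>

section \<open>Harmonic functions\<close>

text \<open>Values are taken in an arbitrary commutative ring so that a real harmonic function can be
  pushed into the field of rational functions. The condition concerns all sets
  smaller than \<open>d\<close>, as inclusion-exclusion needs; over a ring with torsion the case of
  size \<open>d - 1\<close> alone would be weaker.\<close>

definition harmonic :: "nat \<Rightarrow> ('n::finite set \<Rightarrow> 'r::comm_ring_1) \<Rightarrow> bool" where
  "harmonic d g \<longleftrightarrow> (\<forall>Y. card Y < d \<longrightarrow> (\<Sum>Z | card Z = d \<and> Y \<subseteq> Z. g Z) = 0)"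

definition subset_sum :: "nat \<Rightarrow> ('n::finite set \<Rightarrow> 'r::comm_ring_1) \<Rightarrow> 'n set \<Rightarrow> 'r" where
  "subset_sum d g X = (\<Sum>Z | card Z = d \<and> Z \<subseteq> X. g Z)"

text \<open>Descending induction on \<open>card Y\<close>. Summing the identity for \<open>Y \<union> {e}\<close> over all
  \<open>e \<notin> Y\<close> counts each \<open>Z \<supseteq> Y\<close> exactly \<open>d - card Y\<close> times, and
  this positive integer can be cancelled.\<close>

lemma Harm_imp_harmonic:
  fixes f :: "'n::finite set \<Rightarrow> real"
  assumes "f \<in> Harm d"
  shows "harmonic d f"
proof -
  let ?S = "\<lambda>Y. \<Sum>Z | card Z = d \<and> Y \<subseteq> Z. f Z"
  have "?S Y = 0" if "card Y < d" for Y
    using that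
  proof (induction "d - card Y" arbitrary: Y rule: less_induct)
    case less
    show ?case
    proof (cases "card Y = d - 1")
      case True
      then show ?thesis using assms by (auto simp: Harm_def)
    next
      case False
      have "0 = (\<Sum>e\<in>-Y. ?S (insert e Y))"
      proof (rule sum.neutral[symmetric], rule ballI)
        fix e assume "e \<in> - Y"
        then have "card (insert e Y) = Suc (card Y)"
          by simp
        then show "?S (insert e Y) = 0"
          using less.hyps[of "insert e Y"] less.prems False by simp
      qed
      also have "\<dots> = (\<Sum>Z | card Z = d \<and> Y \<subseteq> Z. \<Sum>e | e \<in> -Y \<and> e \<in> Z. f Z)"
      proof -
        have "(\<Sum>e\<in>-Y. ?S (insert e Y))
            = (\<Sum>e\<in>-Y. \<Sum>Z | Z \<in> {Z. card Z = d \<and> Y \<subseteq> Z} \<and> e \<in> Z. f Z)"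
          by (intro sum.cong) auto
        also have "\<dots> = (\<Sum>Z | card Z = d \<and> Y \<subseteq> Z. \<Sum>e | e \<in> -Y \<and> e \<in> Z. f Z)"
          by (rule sum.swap_restrict) auto
        finally show ?thesis .
      qed
      also have "\<dots> = (\<Sum>Z | card Z = d \<and> Y \<subseteq> Z. real (d - card Y) * f Z)"
      proof (rule sum.cong[OF refl])
        fix Z assume Z: "Z \<in> {Z. card Z = d \<and> Y \<subseteq> Z}"
        have "{e. e \<in> -Y \<and> e \<in> Z} = Z - Y" by auto
        then show "(\<Sum>e | e \<in> -Y \<and> e \<in> Z. f Z) = real (d - card Y) * f Z"
          using Z by (simp add: card_Diff_subset)
      qed
      also have "\<dots> = real (d - card Y) * ?S Y"
        by (rule sum_distrib_left[symmetric])
      finally show ?thesis using less.prems by simp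
    qed
  qed
  then show ?thesis by (auto simp: harmonic_def)
qed

text \<open>The binomial theorem, indexed by subsets instead of cardinalities.\<close>

lemma sum_powers_Pow:
  fixes a b :: "'r::comm_ring_1"
  assumes "finite A"
  shows "(\<Sum>Y\<in>Pow A. a ^ card Y * b ^ (card A - card Y)) = (a + b) ^ card A"
proof -
  have "(a + b) ^ card A = (\<Prod>x\<in>A. a + b)" by simp
  also have "\<dots> = (\<Sum>Y\<in>Pow A. (\<Prod>x\<in>Y. a) * (\<Prod>x\<in>A - Y. b))"
    by (rule prod_add[OF assms])
  also have "\<dots> = (\<Sum>Y\<in>Pow A. a ^ card Y * b ^ (card A - card Y))"
    using assms by (intro sum.cong) (auto simp: card_Diff_subset finite_subset)
  finally show ?thesis by simp
qed

text \<open>Writing \<open>x = (x - y) + y\<close>, the binomial theorem over the subsets \<open>Y\<close> of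
  \<open>Z \<inter> S\<close> turns the left side into a sum over \<open>Y \<subseteq> S\<close> of
  \<open>(x - y) ^ card Y * y ^ (d - card Y)\<close> times the sum of \<open>g\<close> over the supersets of
  \<open>Y\<close>. By harmonicity only the terms with \<open>card Y = d\<close> survive, and for these the
  sole superset is \<open>Y\<close> itself.\<close>

lemma harmonic_sum_by_intersection:
  fixes g :: "'n::finite set \<Rightarrow> 'r::comm_ring_1"
  assumes "harmonic d g"
  shows "(\<Sum>Z | card Z = d. g Z * x ^ card (Z \<inter> S) * y ^ card (Z - S)) = (x - y) ^ d * subset_sum d g S"
proof -
  have "(\<Sum>Z | card Z = d. g Z * x ^ card (Z \<inter> S) * y ^ card (Z - S))
      = (\<Sum>Z | card Z = d. \<Sum>Y | Y \<in> Pow S \<and> Y \<subseteq> Z. g Z * ((x - y) ^ card Y * y ^ (d - card Y)))"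
  proof (rule sum.cong[OF refl])
    fix Z :: "'n set" assume Z: "Z \<in> {Z. card Z = d}"
    have c: "card (Z \<inter> S) + card (Z - S) = d"
      using Z card_Int_Diff[of Z S] by simp
    have "x ^ card (Z \<inter> S) * y ^ card (Z - S)
        = (\<Sum>Y\<in>Pow (Z \<inter> S). (x - y) ^ card Y * y ^ (card (Z \<inter> S) - card Y)) * y ^ card (Z - S)"
      by (subst sum_powers_Pow) auto
    also have "\<dots> = (\<Sum>Y\<in>Pow (Z \<inter> S). (x - y) ^ card Y * y ^ (d - card Y))"
      unfolding sum_distrib_right
    proof (rule sum.cong[OF refl])
      fix Y assume "Y \<in> Pow (Z \<inter> S)"
      then have "card Y \<le> card (Z \<inter> S)" by (intro card_mono) auto
      then have "d - card Y = (card (Z \<inter> S) - card Y) + card (Z - S)" using c by simp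
      then show "(x - y) ^ card Y * y ^ (card (Z \<inter> S) - card Y) * y ^ card (Z - S)
          = (x - y) ^ card Y * y ^ (d - card Y)"
        by (simp add: power_add mult.assoc)
    qed
    also have "Pow (Z \<inter> S) = {Y. Y \<in> Pow S \<and> Y \<subseteq> Z}" by auto
    finally show "g Z * x ^ card (Z \<inter> S) * y ^ card (Z - S)
        = (\<Sum>Y | Y \<in> Pow S \<and> Y \<subseteq> Z. g Z * ((x - y) ^ card Y * y ^ (d - card Y)))"
      by (simp add: mult.assoc sum_distrib_left)
  qed
  also have "\<dots> = (\<Sum>Y\<in>Pow S. \<Sum>Z | Z \<in> {Z. card Z = d} \<and> Y \<subseteq> Z. g Z * ((x - y) ^ card Y * y ^ (d - card Y)))"
    by (rule sum.swap_restrict[symmetric]) auto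
  also have "\<dots> = (\<Sum>Y\<in>Pow S. if card Y = d then g Y * (x - y) ^ d else 0)"
  proof (rule sum.cong[OF refl])
    fix Y :: "'n set" assume "Y \<in> Pow S"
    let ?A = "{Z. Z \<in> {Z. card Z = d} \<and> Y \<subseteq> Z}"
    show "(\<Sum>Z\<in>?A. g Z * ((x - y) ^ card Y * y ^ (d - card Y)))
        = (if card Y = d then g Y * (x - y) ^ d else 0)"
    proof (cases "card Y" d rule: linorder_cases)
      case less
      then have "(\<Sum>Z\<in>?A. g Z) = 0" using assms by (simp add: harmonic_def)
      then show ?thesis using less by (simp add: sum_distrib_right[symmetric])
    next
      case equal
      then have "?A = {Y}" by (auto dest: card_subset_eq[OF finite])
      then show ?thesis using equal by simp
    next
      case greater
      then have "?A = {}" by (auto dest: card_mono[OF finite])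
      then show ?thesis using greater by (simp only: sum.empty) simp
    qed
  qed
  also have "\<dots> = (\<Sum>Y | card Y = d \<and> Y \<subseteq> S. g Y * (x - y) ^ d)"
    by (subst sum.inter_filter[symmetric]) (auto intro!: sum.cong)
  also have "\<dots> = (x - y) ^ d * subset_sum d g S"
    by (simp add: subset_sum_def sum_distrib_left mult.commute)
  finally show ?thesis .
qed

text \<open>The case \<open>x = 0\<close>, \<open>y = 1\<close> of the preceding identity, in which the weight of
  \<open>Z\<close> is the indicator of \<open>Z \<inter> S = {}\<close>.\<close>

lemma subset_sum_Compl:
  fixes g :: "'n::finite set \<Rightarrow> 'r::comm_ring_1"
  assumes "harmonic d g"
  shows "subset_sum d g (- S) = (- 1) ^ d * subset_sum d g S"
proof -
  have "subset_sum d g (- S) = (\<Sum>Z | card Z = d. g Z * 0 ^ card (Z \<inter> S) * 1 ^ card (Z - S))"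
    unfolding subset_sum_def
    by (rule sum.mono_neutral_cong_left) (auto simp: power_0_left disjoint_eq_subset_Compl[symmetric])
  also have "\<dots> = (0 - 1) ^ d * subset_sum d g S"
    by (rule harmonic_sum_by_intersection[OF assms])
  finally show ?thesis by simp
qed

lemma subset_sum_small: "card S < d \<Longrightarrow> subset_sum d g S = 0"
  unfolding subset_sum_def
  by (rule sum.neutral) (auto dest: card_mono[OF finite])

lemma card_Compl: "card (- S) = CARD('n) - card S" for S :: "'n::finite set"
  by (simp add: Compl_eq_Diff_UNIV card_Diff_subset)

lemma subset_sum_large:
  fixes g :: "'n::finite set \<Rightarrow> 'r::comm_ring_1"
  assumes "harmonic d g" and "CARD('n) < card S + d"
  shows "subset_sum d g S = 0"
proof -
  have "card (- S) < d"
    using assms(2) card_mono[OF finite subset_UNIV, of S] by (simp add: card_Compl)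
  then have "subset_sum d g (- S) = 0" by (rule subset_sum_small)
  then have "(- 1) ^ d * ((- 1) ^ d * subset_sum d g S) = 0"
    by (simp add: subset_sum_Compl[OF assms(1)])
  then show ?thesis by (simp add: mult.assoc[symmetric] power_mult_distrib[symmetric])
qed

text \<open>Every point of \<open>U\<close> contributes a factor \<open>a\<close>, and every other point the
  factor \<open>a + b\<close> of a free choice.\<close>

lemma sum_supersets:
  fixes a b :: "'r::comm_ring_1" and U :: "'n::finite set"
  shows "(\<Sum>X | U \<subseteq> X. a ^ card X * b ^ (CARD('n) - card X))
    = a ^ card U * (a + b) ^ (CARD('n) - card U)"
proof -
  have "(\<Sum>X | U \<subseteq> X. a ^ card X * b ^ (CARD('n) - card X))
      = (\<Sum>Y\<in>Pow (-U). a ^ card U * (a ^ card Y * b ^ (card (- U) - card Y)))"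
  proof (rule sum.reindex_bij_witness[of _ "\<lambda>Y. U \<union> Y" "\<lambda>X. X - U"])
    fix X assume "X \<in> {X. U \<subseteq> X}"
    then have "card X = card U + card (X - U)"
      using card_Int_Diff[of X U] by (simp add: Int_absorb1)
    then show "a ^ card U * (a ^ card (X - U) * b ^ (card (- U) - card (X - U)))
        = a ^ card X * b ^ (CARD('n) - card X)"
      by (simp add: power_add mult.assoc card_Compl)
  qed auto
  also have "\<dots> = a ^ card U * (a + b) ^ card (- U)"
    by (simp add: sum_distrib_left[symmetric] sum_powers_Pow)
  finally show ?thesis by (simp add: card_Compl)
qed

text \<open>The inversion formula that links the two sides of the theorem. Expand \<open>subset_sum\<close> on the
  left as a sum over \<open>Z\<close>; the supersets of \<open>S \<union> Z\<close> have total weight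
  \<open>y ^ card (S \<union> Z) * x ^ (n - card (S \<union> Z))\<close>, where \<open>n = CARD('n)\<close>.
  This depends on \<open>Z\<close> only through \<open>Z \<inter> S\<close> and \<open>Z - S\<close>, so
  \<open>harmonic_sum_by_intersection\<close> evaluates the sum over \<open>Z\<close>. The factor
  \<open>(x - y) ^ d\<close> that it produces is the one removed by the shift of the exponents
  by \<open>d\<close>.\<close>

lemma harmonic_sum_supersets:
  fixes g :: "'n::finite set \<Rightarrow> 'r::field"
  assumes "harmonic d g" and nz: "x \<noteq> 0" "y \<noteq> 0" "x \<noteq> y"
  shows "(\<Sum>X | S \<subseteq> X. subset_sum d g X * y powi (int (card X) - int d)
             * (x - y) powi (int CARD('n) - int (card X) - int d))
    = subset_sum d g S * y powi (int (card S) - int d)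
        * x powi (int CARD('n) - int (card S) - int d)"
proof -
  let ?n = "CARD('n)"
  have "(\<Sum>X | S \<subseteq> X. subset_sum d g X * (y ^ card X * (x - y) ^ (?n - card X)))
      = (\<Sum>X | X \<in> {X. S \<subseteq> X}. \<Sum>Z | Z \<in> {Z. card Z = d} \<and> Z \<subseteq> X. g Z * (y ^ card X * (x - y) ^ (?n - card X)))"
    by (simp add: subset_sum_def sum_distrib_right)
  also have "\<dots> = (\<Sum>Z | card Z = d. \<Sum>X | X \<in> {X. S \<subseteq> X} \<and> Z \<subseteq> X. g Z * (y ^ card X * (x - y) ^ (?n - card X)))"
    using sum.swap_restrict[of "{X. S \<subseteq> X}" "{Z. card Z = d}" _ "\<lambda>X Z. Z \<subseteq> X"] by simp
  also have "\<dots> = (\<Sum>Z | card Z = d. g Z * (y ^ card (S \<union> Z) * x ^ (?n - card (S \<union> Z))))"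
  proof (rule sum.cong[OF refl])
    fix Z :: "'n set"
    have "{X. X \<in> {X. S \<subseteq> X} \<and> Z \<subseteq> X} = {X. S \<union> Z \<subseteq> X}" by auto
    then show "(\<Sum>X | X \<in> {X. S \<subseteq> X} \<and> Z \<subseteq> X. g Z * (y ^ card X * (x - y) ^ (?n - card X)))
        = g Z * (y ^ card (S \<union> Z) * x ^ (?n - card (S \<union> Z)))"
      using sum_supersets[of y "x - y" "S \<union> Z"] by (simp add: sum_distrib_left[symmetric])
  qed
  also have "\<dots> = (\<Sum>Z | card Z = d. y ^ card S * x powi (int ?n - int (card S) - int d)
      * (g Z * x ^ card (Z \<inter> S) * y ^ card (Z - S)))"
  proof (rule sum.cong[OF refl])
    fix Z :: "'n set" assume Z: "Z \<in> {Z. card Z = d}"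
    have c: "card (S \<union> Z) = card S + card (Z - S)"
      using card_Un_disjoint[of S "Z - S"] by simp
    have d: "card (Z \<inter> S) + card (Z - S) = d"
      using Z card_Int_Diff[of Z S] by simp
    have le: "card (S \<union> Z) \<le> ?n" by (rule card_mono) auto
    have "x ^ (?n - card (S \<union> Z)) = x powi int (?n - card (S \<union> Z))" by simp
    also have "int (?n - card (S \<union> Z)) = int ?n - int (card S) - int d + int (card (Z \<inter> S))"
      using c d le by linarith
    also have "x powi \<dots> = x powi (int ?n - int (card S) - int d) * x ^ card (Z \<inter> S)"
      using nz by (simp add: power_int_add)
    finally show "g Z * (y ^ card (S \<union> Z) * x ^ (?n - card (S \<union> Z)))
        = y ^ card S * x powi (int ?n - int (card S) - int d)
            * (g Z * x ^ card (Z \<inter> S) * y ^ card (Z - S))"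
      by (simp add: c power_add mult_ac)
  qed
  also have "\<dots> = y ^ card S * x powi (int ?n - int (card S) - int d) * ((x - y) ^ d * subset_sum d g S)"
    by (simp add: sum_distrib_left[symmetric] harmonic_sum_by_intersection[OF assms(1)])
  finally have main: "(\<Sum>X | S \<subseteq> X. subset_sum d g X * (y ^ card X * (x - y) ^ (?n - card X)))
      = y ^ card S * x powi (int ?n - int (card S) - int d) * ((x - y) ^ d * subset_sum d g S)" .
  \<comment> \<open>Dividing by the powers of \<open>y\<close> and \<open>x - y\<close> shifts both exponents by \<open>d\<close>.\<close>
  have yp: "y powi (int c - int d) = y ^ c / y ^ d" for c
    using nz by (simp add: power_int_diff)
  have zp: "(x - y) powi (int ?n - int (card X) - int d) = (x - y) ^ (?n - card X) / (x - y) ^ d"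
    for X :: "'n set"
  proof -
    have "card X \<le> ?n" by (rule card_mono) auto
    then have "int ?n - int (card X) = int (?n - card X)" by simp
    moreover have "(x - y) powi (int (?n - card X) - int d) = (x - y) ^ (?n - card X) / (x - y) ^ d"
      by (subst power_int_diff) (use nz in auto)
    ultimately show ?thesis by (simp only:)
  qed
  have "(\<Sum>X | S \<subseteq> X. subset_sum d g X * y powi (int (card X) - int d)
             * (x - y) powi (int ?n - int (card X) - int d))
      = (\<Sum>X | S \<subseteq> X. subset_sum d g X * (y ^ card X * (x - y) ^ (?n - card X))) / (y ^ d * (x - y) ^ d)"
    unfolding sum_divide_distrib yp zp
    by (rule sum.cong[OF refl])
      (simp only: times_divide_times_eq times_divide_eq_left times_divide_eq_right
        mult.assoc divide_divide_eq_left mult.commute mult.left_commute)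
  also have "\<dots> = subset_sum d g S * (y ^ card S / y ^ d) * x powi (int ?n - int (card S) - int d)"
    unfolding main using nz by (simp add: divide_simps)
  finally show ?thesis unfolding yp .
qed

section \<open>Codewords vanishing on a set of coordinates\<close>

text \<open>A right inverse of the restriction of \<open>D\<close> to the coordinates in \<open>I\<close>: when
  \<open>D\<close> is a subspace, every prescription of values on \<open>I\<close> is met by a word of
  \<open>D\<close>. In coding terms, \<open>I\<close> is contained in an information set. Applying a field
  embedding to all coordinates preserves this, so the rank over the small field also governs the
  extended code.\<close>

definition dual_family :: "'n set \<Rightarrow> ('a::{field} ^ 'n) set \<Rightarrow> ('n \<Rightarrow> 'a ^ 'n) \<Rightarrow> bool" where
  "dual_family I D v \<longleftrightarrow> (\<forall>i\<in>I. v i \<in> D \<and> (\<forall>j\<in>I. v i $ j = (if i = j then 1 else 0)))"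

lemma columns_independentD:
  assumes "columns_independent k G I" "\<And>r. r < k \<Longrightarrow> (\<Sum>i\<in>I. c i * G r $ i) = 0" "i \<in> I"
  shows "c i = 0"
  using assms unfolding columns_independent_def by blast

lemma columns_independent_subset:
  assumes "columns_independent k G J" "I \<subseteq> J"
  shows "columns_independent k G I"
  unfolding columns_independent_def
proof (intro allI impI)
  fix c assume c: "\<forall>r<k. (\<Sum>i\<in>I. c i * G r $ i) = 0"
  let ?c = "\<lambda>i. if i \<in> I then c i else 0"
  have "(\<Sum>i\<in>J. ?c i * G r $ i) = (\<Sum>i\<in>I. c i * G r $ i)" for r
    using assms(2) by (intro sum.mono_neutral_cong_right) auto
  then have "?c i = 0" if "i \<in> J" for i
    using c that by (intro columns_independentD[OF assms(1), of ?c]) auto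
  with assms(2) show "\<forall>i\<in>I. c i = 0" by (metis subsetD)
qed

text \<open>This makes a maximal independent set of columns inside \<open>Y\<close> control all of
  \<open>Y\<close>: a word vanishing on the former vanishes on the latter.\<close>

lemma dependent_column_combination:
  assumes I: "columns_independent k G I" and j: "j \<notin> I" "\<not> columns_independent k G (insert j I)"
  shows "\<exists>a. \<forall>r<k. G r $ j = (\<Sum>i\<in>I. a i * G r $ i)"
proof -
  from j obtain c where c: "\<And>r. r < k \<Longrightarrow> (\<Sum>i\<in>insert j I. c i * G r $ i) = 0"
    and nz: "\<exists>i\<in>insert j I. c i \<noteq> 0"
    unfolding columns_independent_def by blast
  have c': "c j * G r $ j + (\<Sum>i\<in>I. c i * G r $ i) = 0" if "r < k" for r
    using c[OF that] j(1) by simp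
  have "c j \<noteq> 0"
  proof
    assume 0: "c j = 0"
    then have "\<forall>r<k. (\<Sum>i\<in>I. c i * G r $ i) = 0" using c' by simp
    then have "\<forall>i\<in>I. c i = 0" using I unfolding columns_independent_def by blast
    with nz 0 show False by auto
  qed
  have "G r $ j = (\<Sum>i\<in>I. (- c i / c j) * G r $ i)" if "r < k" for r
  proof -
    have "(\<Sum>i\<in>I. (- c i / c j) * G r $ i) = - (\<Sum>i\<in>I. c i * G r $ i) / c j"
      by (simp add: sum_negf[symmetric] sum_divide_distrib)
    also have "- (\<Sum>i\<in>I. c i * G r $ i) = c j * G r $ j"
      using c'[OF that] by (metis add_eq_0_iff2)
    finally show ?thesis using \<open>c j \<noteq> 0\<close> by simp
  qed
  then show ?thesis by (intro exI[of _ "\<lambda>i. - c i / c j"]) blast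
qed

text \<open>Induction on the set of columns. Given a dual family \<open>v\<close> on \<open>I\<close>, subtract from each
  row its part along \<open>v\<close>; the remainders vanish on \<open>I\<close>. If all of them vanished at
  the new column \<open>j\<close> too, this column would be the combination of the columns in
  \<open>I\<close> with coefficients \<open>v i $ j\<close>. So one remainder is nonzero at \<open>j\<close>;
  scaled to be 1 there, it is the new member and corrects the old ones at \<open>j\<close>.\<close>

lemma independent_columns_dual_family:
  fixes G :: "nat \<Rightarrow> 'a::field ^ 'n::finite"
  assumes "columns_independent k G I"
  shows "\<exists>v. dual_family I (vec.span (G ` {..<k})) v"
  using finite[of I] assms
proof (induction I rule: finite_induct)
  case empty
  then show ?case by (simp add: dual_family_def)
next
  case (insert j I)
  let ?C = "vec.span (G ` {..<k})"
  have "columns_independent k G I"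
    using insert.prems by (rule columns_independent_subset) auto
  then obtain v where v: "dual_family I ?C v" using insert.IH by blast
  have vC: "v i \<in> ?C" if "i \<in> I" for i using v that by (auto simp: dual_family_def)
  have v1: "v i $ l = (if i = l then 1 else 0)" if "i \<in> I" "l \<in> I" for i l
    using v that by (auto simp: dual_family_def)
  let ?w = "\<lambda>r. G r - (\<Sum>i\<in>I. G r $ i *s v i)"
  have wC: "?w r \<in> ?C" if "r < k" for r
    using that vC
    by (intro vec.span_diff vec.span_sum vec.span_scale) (auto intro: vec.span_base)
  have w0: "?w r $ l = 0" if "l \<in> I" for r l
  proof -
    have "(\<Sum>i\<in>I. G r $ i * v i $ l) = (\<Sum>i\<in>I. if i = l then G r $ i else 0)"
      using that by (intro sum.cong) (auto simp: v1)
    then show ?thesis using that by simp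
  qed
  have "\<exists>r<k. ?w r $ j \<noteq> 0"
  proof (rule ccontr)
    assume "\<not> (\<exists>r<k. ?w r $ j \<noteq> 0)"
    then have dep: "G r $ j = (\<Sum>i\<in>I. G r $ i * v i $ j)" if "r < k" for r
      using that by auto
    let ?c = "\<lambda>i. if i = j then 1 else - v i $ j"
    have "(\<Sum>i\<in>insert j I. ?c i * G r $ i) = 0" if "r < k" for r
    proof -
      have "(\<Sum>i\<in>I. ?c i * G r $ i) = (\<Sum>i\<in>I. - (G r $ i * v i $ j))"
        using insert.hyps by (intro sum.cong) auto
      then show ?thesis
        using insert.hyps dep[OF that] by (simp add: sum_negf)
    qed
    then have "?c j = 0" by (rule columns_independentD[OF insert.prems]) auto
    then show False by simp
  qed
  then obtain r where r: "r < k" "?w r $ j \<noteq> 0" by blast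
  define w where "w = (1 / ?w r $ j) *s ?w r"
  have w: "w \<in> ?C" "w $ j = 1" "\<And>l. l \<in> I \<Longrightarrow> w $ l = 0"
    using wC[OF r(1)] r(2) w0 unfolding w_def by (auto intro!: vec.span_scale)
  have "dual_family (insert j I) ?C (\<lambda>i. if i = j then w else v i - v i $ j *s w)"
    unfolding dual_family_def using insert.hyps w vC v1
    by (auto intro!: vec.span_diff vec.span_scale)
  then show ?case by blast
qed

text \<open>Restriction to \<open>I\<close> is onto all functions on \<open>I\<close>, and its kernel is the subspace of
  words vanishing on \<open>I\<close>.\<close>

lemma card_subspace_dual_family:
  fixes D :: "('b::{field,finite} ^ 'n::finite) set"
  assumes D: "vec.subspace D" and v: "dual_family I D v"
  shows "card D = CARD('b) ^ card I * card {u \<in> D. \<forall>i\<in>I. u $ i = 0}"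
proof -
  let ?K = "{u \<in> D. \<forall>i\<in>I. u $ i = 0}"
  let ?s = "\<lambda>c. \<Sum>i\<in>I. c i *s v i"
  have vD: "v i \<in> D" if "i \<in> I" for i using v that by (auto simp: dual_family_def)
  have sD: "?s c \<in> D" for c
    using vD by (intro vec.subspace_sum[OF D] vec.subspace_scale[OF D])
  have s: "?s c $ l = c l" if "l \<in> I" for c l
  proof -
    have "?s c $ l = (\<Sum>i\<in>I. c i * v i $ l)" by simp
    also have "\<dots> = (\<Sum>i\<in>I. if i = l then c i else 0)"
      using that v by (intro sum.cong) (auto simp: dual_family_def)
    finally have "?s c $ l = (\<Sum>i\<in>I. if i = l then c i else 0)" .
    then show ?thesis using that by simp
  qed
  have "bij_betw (\<lambda>u. (restrict (\<lambda>i. u $ i) I, u - ?s (\<lambda>i. u $ i))) D ((I \<rightarrow>\<^sub>E UNIV) \<times> ?K)"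
  proof (rule bij_betw_byWitness[where f' = "\<lambda>(c, w). w + ?s c"])
    show "\<forall>u\<in>D. (case (restrict (\<lambda>i. u $ i) I, u - ?s (\<lambda>i. u $ i)) of (c, w) \<Rightarrow> w + ?s c) = u"
      by simp
    show "\<forall>p\<in>(I \<rightarrow>\<^sub>E UNIV) \<times> ?K. (\<lambda>u. (restrict (\<lambda>i. u $ i) I, u - ?s (\<lambda>i. u $ i)))
        (case p of (c, w) \<Rightarrow> w + ?s c) = p"
    proof (intro ballI, clarify)
      fix c :: "'n \<Rightarrow> 'b" and w :: "'b ^ 'n"
      assume c: "c \<in> I \<rightarrow>\<^sub>E UNIV" and w: "w \<in> D" "\<forall>i\<in>I. w $ i = 0"
      have l: "(w + ?s c) $ l = c l" if "l \<in> I" for l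
        using that w s[OF that, of c] by simp
      then have "restrict (\<lambda>i. (w + ?s c) $ i) I = c"
        using c by (auto simp: fun_eq_iff PiE_def extensional_def)
      moreover have "?s (\<lambda>i. (w + ?s c) $ i) = ?s c"
        by (rule sum.cong[OF refl]) (simp only: l)
      ultimately show "restrict (\<lambda>i. (w + ?s c) $ i) I = c \<and> w + ?s c - ?s (\<lambda>i. (w + ?s c) $ i) = w"
        by (simp only:) simp
    qed
    show "(\<lambda>u. (restrict (\<lambda>i. u $ i) I, u - ?s (\<lambda>i. u $ i))) ` D \<subseteq> (I \<rightarrow>\<^sub>E UNIV) \<times> ?K"
    proof (intro image_subsetI, intro SigmaI)
      fix u assume u: "u \<in> D"
      have "(u - ?s (\<lambda>i. u $ i)) $ l = 0" if "l \<in> I" for l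
        using s[OF that] by simp
      then show "u - ?s (\<lambda>i. u $ i) \<in> ?K"
        using vec.subspace_diff[OF D u sD] by blast
    qed auto
    show "(\<lambda>(c, w). w + ?s c) ` ((I \<rightarrow>\<^sub>E UNIV) \<times> ?K) \<subseteq> D"
      using vec.subspace_add[OF D _ sD] by auto
  qed
  then have "card D = card ((I \<rightarrow>\<^sub>E (UNIV :: 'b set)) \<times> ?K)"
    by (rule bij_betw_same_card)
  then show ?thesis by (simp add: card_cartesian_product card_PiE)
qed

lemma matroid_rank_witness:
  fixes G :: "nat \<Rightarrow> 'a::field ^ 'n::finite"
  obtains I where "I \<subseteq> X" "columns_independent k G I" "card I = matroid_rank (vector_matroid k G) X"
    "\<forall>j\<in>X - I. \<not> columns_independent k G (insert j I)"
proof -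
  let ?A = "card ` {I \<in> vector_matroid k G. I \<subseteq> X}"
  have "{} \<in> {I \<in> vector_matroid k G. I \<subseteq> X}"
    by (simp add: vector_matroid_def columns_independent_def)
  then have "Max ?A \<in> ?A" by (intro Max_in) auto
  then obtain I where I: "I \<subseteq> X" "columns_independent k G I" "card I = Max ?A"
    by (auto simp: vector_matroid_def)
  have "\<not> columns_independent k G (insert j I)" if "j \<in> X" "j \<notin> I" for j
  proof
    assume "columns_independent k G (insert j I)"
    then have "card (insert j I) \<in> ?A"
      using I that by (intro imageI) (simp add: vector_matroid_def)
    then have "card (insert j I) \<le> Max ?A" by (intro Max_ge) auto
    then show False using I that by simp
  qed
  with I show thesis by (intro that[of I]) (auto simp: matroid_rank_def)
qed

lemma matroid_rank_mono:
  assumes "X \<subseteq> Y"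
  shows "matroid_rank (vector_matroid k G) X \<le> matroid_rank (vector_matroid k G) Y"
  unfolding matroid_rank_def
proof (rule Max_mono)
  have "{} \<in> {I \<in> vector_matroid k G. I \<subseteq> X}"
    by (simp add: vector_matroid_def columns_independent_def)
  then show "card ` {I \<in> vector_matroid k G. I \<subseteq> X} \<noteq> {}" by blast
qed (use assms in auto)

lemma matroid_rank_le_card: "matroid_rank (vector_matroid k G) X \<le> card X"
proof -
  obtain I where I: "I \<subseteq> X" "columns_independent k G I"
    "card I = matroid_rank (vector_matroid k G) X"
    "\<forall>j\<in>X - I. \<not> columns_independent k G (insert j I)"
    by (rule matroid_rank_witness[of X k G])
  show ?thesis using card_mono[OF finite I(1)] I(3) by simp
qed

lemma field_embedding_sum:
  assumes "field_embedding h"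
  shows "h (\<Sum>i\<in>A. a i) = (\<Sum>i\<in>A. h (a i))"
proof -
  have add: "h (x + y) = h x + h y" for x y using assms by (simp add: field_embedding_def)
  have "h 0 = 0" using add[of 0 0] by (metis add.right_neutral add_left_cancel)
  then show ?thesis
    by (induction A rule: infinite_finite_induct) (auto simp: add)
qed

lemma subspace_column_relation: "vec.subspace {u :: 'a::field ^ 'n. u $ j = (\<Sum>i\<in>I. b i * u $ i)}"
proof (rule vec.subspaceI; clarsimp)
  fix x y :: "'a ^ 'n"
  show "(\<Sum>i\<in>I. b i * x $ i) + (\<Sum>i\<in>I. b i * y $ i) = (\<Sum>i\<in>I. b i * (x $ i + y $ i))"
    by (simp add: distrib_left sum.distrib)
next
  fix c and x :: "'a ^ 'n"
  show "c * (\<Sum>i\<in>I. b i * x $ i) = (\<Sum>i\<in>I. b i * (c * x $ i))"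
    by (simp add: sum_distrib_left mult.left_commute)
qed

lemma span_column_relation:
  fixes G :: "nat \<Rightarrow> 'a::field ^ 'n::finite"
  assumes "\<And>r. r < k \<Longrightarrow> G r $ j = (\<Sum>i\<in>I. a i * G r $ i)"
    and "u \<in> vec.span (G ` {..<k})"
  shows "u $ j = (\<Sum>i\<in>I. a i * u $ i)"
  using vec.span_minimal[OF _ subspace_column_relation, of "G ` {..<k}" j a I] assms by auto

lemma ext_code_column_relation:
  assumes h: "field_embedding h"
    and C: "\<And>u. u \<in> C \<Longrightarrow> u $ j = (\<Sum>i\<in>I. a i * u $ i)"
    and w: "w \<in> ext_code h C"
  shows "w $ j = (\<Sum>i\<in>I. h (a i) * w $ i)"
proof -
  have mult: "h (x * y) = h x * h y" for x y using h by (simp add: field_embedding_def)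
  have "(\<lambda>u. \<chi> i. h (u $ i)) ` C \<subseteq> {u. u $ j = (\<Sum>i\<in>I. h (a i) * u $ i)}"
    using C by (auto simp: field_embedding_sum[OF h] mult)
  from vec.span_minimal[OF this subspace_column_relation] show ?thesis
    using w unfolding ext_code_def by auto
qed

lemma ext_code_dual_family:
  assumes h: "field_embedding h" and v: "dual_family I C v"
  shows "dual_family I (ext_code h C) (\<lambda>i. \<chi> l. h (v i $ l))"
proof -
  have "h 1 = 1" using h by (simp add: field_embedding_def)
  moreover have "h 0 = 0" using field_embedding_sum[OF h, of _ "{}"] by simp
  ultimately show ?thesis
    using v by (auto simp: dual_family_def ext_code_def intro!: vec.span_base)
qed

text \<open>The dual family on a maximal independent set of columns is a basis of the code: it is
  independent by evaluation on these coordinates, and it spans because a word is determined by its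
  values there.\<close>

lemma matroid_rank_UNIV:
  fixes G :: "nat \<Rightarrow> 'a::{field,finite} ^ 'n::finite"
  assumes "generator_matrix k G C"
  shows "matroid_rank (vector_matroid k G) UNIV = vec.dim C"
proof -
  have C: "vec.span (G ` {..<k}) = C" using assms by (simp add: generator_matrix_def)
  obtain J where "J \<subseteq> UNIV" and J: "columns_independent k G J"
    "card J = matroid_rank (vector_matroid k G) UNIV"
    "\<forall>j\<in>UNIV - J. \<not> columns_independent k G (insert j J)"
    by (rule matroid_rank_witness[of UNIV k G])
  obtain v where v: "dual_family J C v"
    using independent_columns_dual_family[OF J(1)] C by blast
  have v1: "v i $ l = (if i = l then 1 else 0)" if "i \<in> J" "l \<in> J" for i l
    using v that by (auto simp: dual_family_def)
  have inj: "inj_on v J"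
    by (rule inj_onI) (metis v1 zero_neq_one)
  have s: "(\<Sum>i\<in>J. c i *s v i) $ l = c l" if "l \<in> J" for c l
  proof -
    have "(\<Sum>i\<in>J. c i *s v i) $ l = (\<Sum>i\<in>J. c i * v i $ l)" by simp
    also have "\<dots> = (\<Sum>i\<in>J. if i = l then c i else 0)"
      using that v1 by (intro sum.cong) auto
    finally have "(\<Sum>i\<in>J. c i *s v i) $ l = (\<Sum>i\<in>J. if i = l then c i else 0)" .
    then show ?thesis using that by simp
  qed
  have zero: "u = 0" if u: "u \<in> C" "\<And>i. i \<in> J \<Longrightarrow> u $ i = 0" for u
  proof -
    have "u $ j = 0" for j
    proof (cases "j \<in> J")
      case False
      obtain a where a: "\<And>r. r < k \<Longrightarrow> G r $ j = (\<Sum>i\<in>J. a i * G r $ i)"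
        using dependent_column_combination[OF J(1) False] J(3) False by blast
      have "u $ j = (\<Sum>i\<in>J. a i * u $ i)"
        by (rule span_column_relation[OF a]) (use u C in auto)
      then show ?thesis using u by simp
    qed (use u in auto)
    then show ?thesis by (simp add: vec_eq_iff)
  qed
  have "vec.independent (v ` J)"
  proof (rule vec.independent_if_scalars_zero)
    fix c x assume c: "(\<Sum>x\<in>v ` J. c x *s x) = 0" and x: "x \<in> v ` J"
    then obtain l where l: "l \<in> J" "x = v l" by auto
    have "(\<Sum>i\<in>J. c (v i) *s v i) = 0" using c inj by (simp add: sum.reindex)
    then show "c x = 0" using s[OF l(1), of "\<lambda>i. c (v i)"] l by simp
  qed simp
  moreover have "C \<subseteq> vec.span (v ` J)"
  proof
    fix u assume u: "u \<in> C"
    let ?s = "\<Sum>i\<in>J. u $ i *s v i"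
    have sub: "vec.subspace C" using C by (metis vec.subspace_span)
    have "?s \<in> C" using v
      by (intro vec.subspace_sum[OF sub] vec.subspace_scale[OF sub]) (auto simp: dual_family_def)
    then have "u - ?s \<in> C" using u by (intro vec.subspace_diff[OF sub])
    then have "u - ?s = 0" using s by (intro zero) auto
    then have "u = ?s" by simp
    also have "?s \<in> vec.span (v ` J)"
      by (intro vec.span_sum vec.span_scale vec.span_base) auto
    finally show "u \<in> vec.span (v ` J)" .
  qed
  moreover have "v ` J \<subseteq> C" using v by (auto simp: dual_family_def)
  ultimately have "vec.dim C = card J"
    by (intro vec.dim_unique) (auto simp: card_image[OF inj])
  then show ?thesis using J by simp
qed

text \<open>A maximal independent set of columns inside \<open>Y\<close> has a dual family in the extended code and
  detects vanishing on \<open>Y\<close>, so the extended code has size \<open>CARD('b)\<close> to the rank of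
  \<open>Y\<close>, times the number of its words vanishing on \<open>Y\<close>. Taking \<open>Y = UNIV\<close>,
  where that number is 1, gives the size of the extended code itself.\<close>

lemma card_ext_code_vanishing:
  fixes G :: "nat \<Rightarrow> 'a::{field,finite} ^ 'n::finite" and h :: "'a \<Rightarrow> 'b::{field,finite}"
  assumes h: "field_embedding h" and G: "generator_matrix k G C"
  shows "card {w \<in> ext_code h C. \<forall>i\<in>Y. w $ i = 0}
    = CARD('b) ^ (matroid_rank (vector_matroid k G) UNIV - matroid_rank (vector_matroid k G) Y)"
proof -
  let ?D = "ext_code h C" and ?r = "matroid_rank (vector_matroid k G)"
  have C: "vec.span (G ` {..<k}) = C" using G by (simp add: generator_matrix_def)
  have sub: "vec.subspace ?D" by (simp add: ext_code_def)
  have key: "card ?D = CARD('b) ^ ?r Y * card {w \<in> ?D. \<forall>i\<in>Y. w $ i = 0}" for Y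
  proof -
    obtain I where I: "I \<subseteq> Y" "columns_independent k G I" "card I = ?r Y"
      "\<forall>j\<in>Y - I. \<not> columns_independent k G (insert j I)"
      by (rule matroid_rank_witness[of Y k G])
    obtain v where v: "dual_family I C v"
      using independent_columns_dual_family[OF I(2)] C by blast
    have "w $ j = 0" if w: "w \<in> ?D" "\<forall>i\<in>I. w $ i = 0" and j: "j \<in> Y" for w j
    proof (cases "j \<in> I")
      case False
      obtain a where a: "\<And>r. r < k \<Longrightarrow> G r $ j = (\<Sum>i\<in>I. a i * G r $ i)"
        using dependent_column_combination[OF I(2) False] I(4) j False by blast
      have "u $ j = (\<Sum>i\<in>I. a i * u $ i)" if "u \<in> C" for u
        by (rule span_column_relation[OF a]) (use that C in auto)
      from ext_code_column_relation[OF h this w(1)] show ?thesis using w(2) by simp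
    qed (use w in auto)
    then have "{w \<in> ?D. \<forall>i\<in>I. w $ i = 0} = {w \<in> ?D. \<forall>i\<in>Y. w $ i = 0}"
      using I(1) by blast
    then show ?thesis
      using card_subspace_dual_family[OF sub ext_code_dual_family[OF h v]] I(3) by simp
  qed
  have "{w \<in> ?D. \<forall>i\<in>UNIV. w $ i = 0} = {0}"
    using vec.subspace_0[OF sub] by (auto simp: vec_eq_iff)
  then have "card ?D = CARD('b) ^ ?r UNIV" using key[of UNIV] by simp
  also have "\<dots> = CARD('b) ^ ?r Y * CARD('b) ^ (?r UNIV - ?r Y)"
    using matroid_rank_mono[of Y UNIV k G] by (simp add: power_add[symmetric])
  finally show ?thesis using key[of Y] by simp
qed

section \<open>Substitution into bivariate polynomials\<close>

definition ring_hom :: "('a::comm_ring_1 \<Rightarrow> 'b::comm_ring_1) \<Rightarrow> bool" where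
  "ring_hom g \<longleftrightarrow> g 1 = 1 \<and> (\<forall>a b. g (a + b) = g a + g b) \<and> (\<forall>a b. g (a * b) = g a * g b)"

lemma ring_homD:
  assumes "ring_hom g"
  shows "g 0 = 0" "g 1 = 1" "g (a + b) = g a + g b" "g (a * b) = g a * g b"
    "g (a - b) = g a - g b" "g (a ^ i) = g a ^ i" "g (sum t A) = (\<Sum>x\<in>A. g (t x))"
proof -
  show one: "g 1 = 1" and add: "g (a + b) = g a + g b" and mult: "g (a * b) = g a * g b" for a b
    using assms by (auto simp: ring_hom_def)
  show zero: "g 0 = 0" using add[of 0 0] by (metis add.right_neutral add_left_cancel)
  show "g (a - b) = g a - g b" using add[of "a - b" b] by (simp add: algebra_simps)
  show "g (a ^ i) = g a ^ i" by (induction i) (simp_all add: one mult)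
  show "g (sum t A) = (\<Sum>x\<in>A. g (t x))"
    by (induction A rule: infinite_finite_induct) (simp_all add: zero add)
qed

lemma ring_hom_poly_map_poly:
  assumes "ring_hom g"
  shows "ring_hom (\<lambda>p. poly (map_poly g p) b)"
proof -
  let ?E = "\<lambda>p. poly (map_poly g p) b"
  note g = ring_homD[OF assms]
  have pc: "?E (pCons c p) = g c + b * ?E p" for c p
    by (simp add: map_poly_pCons g(1))
  have add: "?E (p + p') = ?E p + ?E p'" for p p'
    by (induction p p' rule: poly_induct2) (simp_all add: pc g algebra_simps)
  have smult: "?E (smult c p) = g c * ?E p" for c p
    by (induction p) (simp_all add: pc g algebra_simps)
  have "?E (p * p') = ?E p * ?E p'" for p p'
    by (induction p) (simp_all add: mult_pCons_left add smult pc g algebra_simps)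
  moreover have "?E 1 = 1"
    using pc[of 1 0] by (simp add: g one_pCons)
  ultimately show ?thesis using add by (simp add: ring_hom_def)
qed

lemma ring_hom_const: "ring_hom (\<lambda>r. to_fract (const2 r))"
  by (simp add: ring_hom_def const2_def one_pCons flip: to_fract_add to_fract_mult to_fract_1)

text \<open>\<open>subst2\<close> nests two evaluations along a coefficient map, and evaluation along a ring
  homomorphism is again one.\<close>

lemma ring_hom_subst2: "ring_hom (\<lambda>p. subst2 p a b)"
  unfolding subst2_def by (intro ring_hom_poly_map_poly ring_hom_const)

lemma poly_map_poly_generators:
  assumes "ring_hom g"
  shows "poly (map_poly g [:r:]) b = g r" "poly (map_poly g [:0, 1:]) b = b"
  using ring_homD(1,2)[OF assms] by (simp_all add: map_poly_pCons)

lemma subst2_simps: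
  "subst2 varX a b = a" "subst2 varY a b = b" "subst2 (const2 r) a b = to_fract (const2 r)"
proof -
  note inner = poly_map_poly_generators[OF ring_hom_const]
  note outer = poly_map_poly_generators[OF ring_hom_poly_map_poly[OF ring_hom_const]]
  show "subst2 varX a b = a"
    unfolding subst2_def varX_def by (subst outer) (rule inner)
  show "subst2 varY a b = b"
    unfolding subst2_def varY_def by (rule outer)
  have "subst2 [:[:r:]:] a b = to_fract (const2 r)"
    unfolding subst2_def by (subst outer) (rule inner)
  then show "subst2 (const2 r) a b = to_fract (const2 r)"
    by (simp only: const2_def[of r])
qed

lemma powi_diff_of_nat:
  fixes z :: "'r::field"
  assumes "i \<le> j"
  shows "z powi (int j - int i) = z ^ (j - i)" "z powi (int i - int j) = inverse (z ^ (j - i))"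
proof -
  have e: "int j - int i = int (j - i)" "int i - int j = - int (j - i)" using assms by auto
  show "z powi (int j - int i) = z ^ (j - i)" unfolding e by (rule power_int_of_nat)
  show "z powi (int i - int j) = inverse (z ^ (j - i))"
    unfolding e by (simp only: power_int_minus power_int_of_nat)
qed

section \<open>The weight enumerator and the Tutte polynomial\<close>

text \<open>Here \<open>z\<close> stands for \<open>x - y\<close>, \<open>r\<close> for the rank of a set of size
  \<open>s\<close>, and \<open>Q * y / z\<close>, \<open>z / y\<close> for the two arguments of the Tutte
  polynomial minus 1. After multiplication by the prefactor, the rank survives only in a power
  of \<open>Q\<close>, which can then be read as the number of codewords vanishing on the set.\<close>

lemma tutte_monomial:
  fixes y z Q :: "'r::field"
  assumes nz: "y \<noteq> 0" "z \<noteq> 0" and le: "r \<le> k" "r \<le> s"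
  shows "z powi (int k - int d) * y powi (int n - int k - int d)
      * ((Q * y / z) ^ (k - r) * (z / y) ^ (s - r))
    = Q ^ (k - r) * y powi (int n - int s - int d) * z powi (int s - int d)"
proof -
  have Q: "(Q * y / z) ^ (k - r) = Q ^ (k - r) * y powi (int k - int r) * z powi (int r - int k)"
    by (simp only: powi_diff_of_nat[OF le(1)] power_mult_distrib power_inverse divide_inverse)
  have zy: "(z / y) ^ (s - r) = z powi (int s - int r) * y powi (int r - int s)"
    by (simp only: powi_diff_of_nat[OF le(2)] power_mult_distrib power_inverse divide_inverse)
  have z: "z powi (int k - int d) * z powi (int r - int k) * z powi (int s - int r)
      = z powi (int s - int d)"
    using nz by (simp flip: power_int_add)
  have y: "y powi (int n - int k - int d) * y powi (int k - int r) * y powi (int r - int s)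
      = y powi (int n - int s - int d)"
  proof -
    have e: "int n - int s - int d = int n - int k - int d + (int k - int r) + (int r - int s)"
      by simp
    show ?thesis unfolding e by (simp only: power_int_add[OF disjI1[OF nz(1)]])
  qed
  have "z powi (int k - int d) * y powi (int n - int k - int d)
      * ((Q * y / z) ^ (k - r) * (z / y) ^ (s - r))
    = Q ^ (k - r)
      * (y powi (int n - int k - int d) * y powi (int k - int r) * y powi (int r - int s))
      * (z powi (int k - int d) * z powi (int r - int k) * z powi (int s - int r))"
    unfolding Q zy by (simp only: mult_ac)
  then show ?thesis unfolding y z .
qed

text \<open>Integer exponents allow the sum to run over the whole code: the words whose exponents would be
  negative have coefficient 0.\<close>

lemma to_fract_harm_Z:
  fixes d :: nat and f :: "'n::finite set \<Rightarrow> real" and D :: "('b::{field,finite} ^ 'n) set"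
  defines "F \<equiv> \<lambda>X. to_fract (const2 (harm_tilde d f X))"
  assumes zero: "\<And>X. card X < d \<or> CARD('n) < card X + d \<Longrightarrow> F X = 0"
  shows "to_fract (harm_Z d f D)
    = (\<Sum>u\<in>D. F (supp u) * to_fract varX powi (int CARD('n) - int (wt u) - int d)
                * to_fract varY powi (int (wt u) - int d))"
proof -
  let ?n = "CARD('n)" and ?x = "to_fract varX" and ?y = "to_fract varY"
  let ?t = "\<lambda>u :: 'b ^ 'n. F (supp u) * ?x powi (int ?n - int (wt u) - int d) * ?y powi (int (wt u) - int d)"
  note c = ring_homD[OF ring_hom_const]
  have pow: "to_fract (p ^ i) = to_fract p ^ i" for p :: "real poly poly" and i
    by (induction i) simp_all
  have "to_fract (harm_Z d f D) = (\<Sum>i = d..?n - d. to_fract (const2 (harm_weight_coeff d f D i))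
      * ?x ^ (?n - i - d) * ?y ^ (i - d))"
    by (simp add: harm_Z_def pow)
  also have "\<dots> = (\<Sum>i = d..?n - d. \<Sum>u | u \<in> {u \<in> D. wt u \<in> {d..?n - d}} \<and> wt u = i. ?t u)"
  proof (rule sum.cong[OF refl])
    fix i assume i: "i \<in> {d..?n - d}"
    have "to_fract (const2 (harm_weight_coeff d f D i)) * ?x ^ (?n - i - d) * ?y ^ (i - d)
        = (\<Sum>u | u \<in> D \<and> wt u = i. F (supp u) * ?x ^ (?n - i - d) * ?y ^ (i - d))"
      by (simp add: harm_weight_coeff_def c F_def sum_distrib_right)
    also have "\<dots> = (\<Sum>u | u \<in> {u \<in> D. wt u \<in> {d..?n - d}} \<and> wt u = i. ?t u)"
    proof (rule sum.cong)
      fix u :: "'b ^ 'n" assume u: "u \<in> {u. u \<in> {u \<in> D. wt u \<in> {d..?n - d}} \<and> wt u = i}"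
      show "F (supp u) * ?x ^ (?n - i - d) * ?y ^ (i - d) = ?t u"
      proof (cases "i + d \<le> ?n")
        case True
        then have e: "int ?n - int i - int d = int (?n - i - d)" "int i - int d = int (i - d)"
          using i by auto
        have "wt u = i" using u by simp
        then show ?thesis by (simp only: e power_int_of_nat)
      next
        case False
        then have "F (supp u) = 0" using u by (intro zero) (auto simp: wt_def)
        then show ?thesis by simp
      qed
    qed (use i in auto)
    finally show "to_fract (const2 (harm_weight_coeff d f D i)) * ?x ^ (?n - i - d) * ?y ^ (i - d)
        = (\<Sum>u | u \<in> {u \<in> D. wt u \<in> {d..?n - d}} \<and> wt u = i. ?t u)" .
  qed
  also have "\<dots> = (\<Sum>u | u \<in> D \<and> wt u \<in> {d..?n - d}. ?t u)"
    by (rule sum.group) auto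
  also have "\<dots> = (\<Sum>u\<in>D. ?t u)"
  proof (rule sum.mono_neutral_left)
    show "\<forall>u\<in>D - {u \<in> D. wt u \<in> {d..?n - d}}. ?t u = 0"
    proof
      fix u assume "u \<in> D - {u \<in> D. wt u \<in> {d..?n - d}}"
      then have "F (supp u) = 0" by (intro zero) (auto simp: wt_def)
      then show "?t u = 0" by simp
    qed
  qed auto
  finally show ?thesis .
qed

theorem theorem4p1:
  fixes C :: "('a::{field,finite} ^ 'n::finite) set"
    and h :: "'a \<Rightarrow> 'b::{field,finite}"
    and G :: "nat \<Rightarrow> 'a ^ 'n"
    and f :: "'n set \<Rightarrow> real"
    and q m n k d :: nat
    and x y :: ratfun2
  defines "x \<equiv> to_fract varX"
    and "y \<equiv> to_fract varY"
  assumes "primepow q" and "CARD('a) = q"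
    and "m \<ge> 1" and "CARD('b) = q ^ m" and "field_embedding h"
    and "CARD('n) = n" and "linear_code k C" and "generator_matrix k G C"
    and "1 \<le> d" and "d \<le> n" and "f \<in> Harm d"
  shows "to_fract (harm_Z d f (ext_code h C)) =
    (- 1) ^ d * (x - y) powi (int k - int d) * y powi (int n - int k - int d)
      * subst2 (harm_tutte (vector_matroid k G) d f)
          ((x + (of_nat (q ^ m) - 1) * y) / (x - y)) (x / y)"
proof -
  let ?D = "ext_code h C" and ?\<rho> = "matroid_rank (vector_matroid k G)"
  define c where "c = (\<lambda>r. to_fract (const2 r) :: ratfun2)"
  define F where "F = subset_sum d (\<lambda>Z. c (f Z))"
  define Q :: ratfun2 where "Q = of_nat (q ^ m)"
  have hom: "ring_hom c" unfolding c_def by (rule ring_hom_const)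
  have F: "c (harm_tilde d f X) = F X" for X
    by (simp add: F_def harm_tilde_def subset_sum_def ring_homD[OF hom])
  have harm: "harmonic d (\<lambda>Z. c (f Z))"
    using Harm_imp_harmonic[OF \<open>f \<in> Harm d\<close>] ring_homD(1)[OF hom]
    by (simp add: harmonic_def ring_homD(7)[OF hom, symmetric])
  have nz: "x \<noteq> 0" "y \<noteq> 0" "x \<noteq> y"
    by (simp_all add: x_def y_def varX_def varY_def)
  then have nz': "x - y \<noteq> 0" by simp
  have rank: "?\<rho> UNIV = k"
    using matroid_rank_UNIV[OF \<open>generator_matrix k G C\<close>] \<open>linear_code k C\<close>
    by (simp add: linear_code_def)
  have card: "CARD('n) = n" by fact
  let ?mon = "\<lambda>X. y powi (int (card X) - int d) * (x - y) powi (int n - int (card X) - int d)"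
  have args: "(x + (of_nat (q ^ m) - 1) * y) / (x - y) - 1 = Q * y / (x - y)"
    "x / y - 1 = (x - y) / y"
    using nz nz' by (simp_all add: Q_def field_simps)
  have "(- 1) ^ d * (x - y) powi (int k - int d) * y powi (int n - int k - int d)
      * subst2 (harm_tutte (vector_matroid k G) d f)
          ((x + (of_nat (q ^ m) - 1) * y) / (x - y)) (x / y)
    = (- 1) ^ d * ((x - y) powi (int k - int d) * y powi (int n - int k - int d)
      * (\<Sum>X\<in>UNIV. F X * ((Q * y / (x - y)) ^ (k - ?\<rho> X) * ((x - y) / y) ^ (card X - ?\<rho> X))))"
    unfolding harm_tutte_def ring_homD[OF ring_hom_subst2] subst2_simps args rank
    by (simp add: F[unfolded c_def] mult.assoc)
  also have "\<dots> = (\<Sum>X\<in>UNIV. (- 1) ^ d * F X * (Q ^ (k - ?\<rho> X)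
      * y powi (int n - int (card X) - int d) * (x - y) powi (int (card X) - int d)))"
    unfolding sum_distrib_left
  proof (rule sum.cong[OF refl])
    fix X :: "'n set"
    have "?\<rho> X \<le> k" using matroid_rank_mono[of X UNIV k G] rank by simp
    from tutte_monomial[OF nz(2) nz' this matroid_rank_le_card, of d n Q]
    show "(- 1) ^ d * ((x - y) powi (int k - int d) * y powi (int n - int k - int d)
        * (F X * ((Q * y / (x - y)) ^ (k - ?\<rho> X) * ((x - y) / y) ^ (card X - ?\<rho> X))))
      = (- 1) ^ d * F X * (Q ^ (k - ?\<rho> X)
          * y powi (int n - int (card X) - int d) * (x - y) powi (int (card X) - int d))"
      by (simp only: mult_ac)
  qed
  \<comment> \<open>Passing to complements absorbs the sign and turns the exponent of \<open>Q\<close> into the dimension of a subcode.\<close>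
  also have "\<dots> = (\<Sum>X\<in>UNIV. F X * ?mon X * Q ^ (k - ?\<rho> (- X)))"
  proof (rule sum.reindex_bij_witness[of _ uminus uminus])
    fix X :: "'n set"
    have le: "card X \<le> n" using card_mono[OF finite subset_UNIV, of X] card by simp
    have sgn: "(- 1) ^ d * F X = F (- X)"
      unfolding F_def using subset_sum_Compl[OF harm, of X] by simp
    have crd: "int (card (- X)) = int n - int (card X)" "int n - (int n - int (card X)) = int (card X)"
      using le by (simp_all add: card_Compl card)
    show "F (- X) * ?mon (- X) * Q ^ (k - ?\<rho> (- (- X)))
        = (- 1) ^ d * F X * (Q ^ (k - ?\<rho> X)
          * y powi (int n - int (card X) - int d) * (x - y) powi (int (card X) - int d))"
      unfolding sgn crd double_complement by (simp only: mult_ac)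
  qed auto
  \<comment> \<open>The power of \<open>Q\<close> counts the codewords supported in \<open>X\<close>.\<close>
  also have "\<dots> = (\<Sum>X\<in>UNIV. \<Sum>u | u \<in> ?D \<and> supp u \<subseteq> X. F X * ?mon X)"
  proof (rule sum.cong[OF refl])
    fix X :: "'n set"
    have "{u \<in> ?D. supp u \<subseteq> X} = {u \<in> ?D. \<forall>i\<in>- X. u $ i = 0}"
      by (auto simp: supp_def)
    then have "card {u \<in> ?D. supp u \<subseteq> X} = (q ^ m) ^ (k - ?\<rho> (- X))"
      using card_ext_code_vanishing[OF \<open>field_embedding h\<close> \<open>generator_matrix k G C\<close>, of "- X"]
        rank \<open>CARD('b) = q ^ m\<close> by simp
    then show "F X * ?mon X * Q ^ (k - ?\<rho> (- X)) = (\<Sum>u | u \<in> ?D \<and> supp u \<subseteq> X. F X * ?mon X)"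
      by (simp add: Q_def)
  qed
  also have "\<dots> = (\<Sum>u\<in>?D. \<Sum>X | X \<in> UNIV \<and> supp u \<subseteq> X. F X * ?mon X)"
    by (rule sum.swap_restrict) auto
  \<comment> \<open>For a fixed codeword, the sum over \<open>X\<close> is the inversion formula for harmonic functions.\<close>
  also have "\<dots> = (\<Sum>u\<in>?D. F (supp u) * x powi (int n - int (wt u) - int d) * y powi (int (wt u) - int d))"
  proof (rule sum.cong[OF refl])
    fix u :: "'b ^ 'n"
    show "(\<Sum>X | X \<in> UNIV \<and> supp u \<subseteq> X. F X * ?mon X)
        = F (supp u) * x powi (int n - int (wt u) - int d) * y powi (int (wt u) - int d)"
      using harmonic_sum_supersets[OF harm nz, of "supp u"] unfolding F_def[symmetric] card
      by (simp add: wt_def mult_ac)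
  qed
  also have "\<dots> = to_fract (harm_Z d f ?D)"
  proof -
    have zero: "c (harm_tilde d f X) = 0" if "card X < d \<or> CARD('n) < card X + d" for X
      using that subset_sum_small[of X d] subset_sum_large[OF harm, of X] unfolding F F_def by blast
    have "to_fract (harm_Z d f ?D) = (\<Sum>u\<in>?D. c (harm_tilde d f (supp u))
        * x powi (int n - int (wt u) - int d) * y powi (int (wt u) - int d))"
      unfolding c_def x_def y_def card[symmetric]
      by (rule to_fract_harm_Z) (rule zero[unfolded c_def])
    then show ?thesis unfolding F by (rule sym)
  qed
  finally show ?thesis by (rule sym)
qed

end
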